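(* Let $F$ be a field of characteristic not $2$, let $(V,B)$ be a finite-dimensional symplectic vector space over $F$, and let $l_1,\ldots,l_n$ ($n\ge 2$) be Lagrangian subspaces of $V$, indexed by $\mathbb Z/n\mathbb Z$. Then the dual form $q^*_{1,2,\ldots,n}$ of $T^*_{1,2,\ldots,n}$, pulled back to a bilinear form on $S_{1,2,\ldots,n}$ along the natural map $S_{1,2,\ldots,n}\to T_{1,2,\ldots,n}^*$, is given by $$q^*_{1,2,\ldots,n}(x,y)=\sum_{i\in\mathbb Z/n\mathbb Z}\big\langle\varepsilon_{i,i+1}(x_i,x_{i+1}),\,y_{i+1}-y_i\big\rangle\qquad (x,y\in S_{1,2,\ldots,n}).$$
   Context: Quadratic space $T_{1,\ldots,n}$: $K_{1,2,\ldots,n}=\{w\in\bigoplus_{i\in\mathbb Z/n\mathbb Z} l_i:\sum_i w_i=0\}$. For $w\in K_{1,\ldots,n}$ an anti-derivative is a family $\hat w=(\hat w_{\{i,i+1\}})_{i\in\mathbb Z/n\mathbb Z}$ of elements of $V$ (one for each edge $\{i,i+1\}$, i.e. for each $i$) with $\hat w_{\{i,i+1\}}-\hat w_{\{i-1,i\}}=w_i$; it exists and is unique up to a constant vector. Put $q_{1,\ldots,n}(v,w)=\sum_iB(v_i,\hat w_{\{i,i+1\}})$ (symmetric, independent of the choice of $\hat w$), and $T_{1,\ldots,n}=K_{1,\ldots,n}/\ker q_{1,\ldots,n}$ with the induced non-degenerate form, also written $q_{1,\ldots,n}$. Dual form: let $\Phi:T_{1,\ldots,n}\to T_{1,\ldots,n}^*$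 be the isomorphism with $q_{1,\ldots,n}(v,w)=\langle v,\Phi w\rangle$. Then $q^*_{1,\ldots,n}(x,y)=\langle x,\Phi^{-1}y\rangle$ for $x,y\in T_{1,\ldots,n}^*$. The space $S_{1,\ldots,n}$: $S_{1,\ldots,n}=\{x\in\bigoplus_{i\in\mathbb Z/n\mathbb Z}V/l_i\ :\ x_{i+1}-x_i\in l_i+l_{i+1}\ \text{for all } i\}$ (i.e. $x_{i+1}\equiv x_i$ modulo $l_i+l_{i+1}$). The natural surjection $S_{1,\ldots,n}\to T_{1,\ldots,n}^*$ sends $x$ to the functional on $T_{1,\ldots,n}$ induced by $v\mapsto\sum_iB(v_i,x_i)$, $v\in K_{1,\ldots,n}$. The functional $\varepsilon_{i,i+1}$: for $x_i,x_{i+1}\in V$ with $x_{i+1}-x_i\in l_i+l_{i+1}$, $\varepsilon_{i,i+1}(x_i,x_{i+1})$ is the functional on $l_i+l_{i+1}$ given, for $v=a+b$ with $a\in l_i$, $b\in l_{i+1}$, by $\langle\varepsilon_{i,i+1}(x_i,x_{i+1}),v\rangle=B(a,x_i)+B(b,x_{i+1})$ (independent of the choice of $a,b$, and dependent only on $x_i$ mod $l_i$ and $x_{i+1}$ mod $l_{i+1}$). In the formula, one chooses lifts of the components $y_i\in V/l_i$ to $V$; the total sum is independent of the lifts. *)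

theory Defs
  imports
    "HOL-Library.Function_Algebras"
    "HOL-Library.Set_Algebras"
    "HOL-Library.FuncSet"
    "Berlekamp_Zassenhaus.Finite_Field"
begin

(* V is the type 'v with scalar multiplication scale.  The index group Z/nZ is 'n mod_ring with
   n = CARD('n), and the class nontriv says exactly that n > 1.  Hence
   families indexed by Z/nZ are plain functions, and index arithmetic is modulo n.
   Addition of families is pointwise (Function_Algebras);  w +o L = {w + u | u. u \<in> L}  and
   A + B = {a + b | a b. a \<in> A \<and> b \<in> B}  (Set_Algebras).  In particular the cosets of L are the
   sets w +o L. *)

definition symplectic_form ::
  "('f::field \<Rightarrow> 'v::ab_group_add \<Rightarrow> 'v) \<Rightarrow> ('v \<Rightarrow> 'v \<Rightarrow> 'f) \<Rightarrow> bool" where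
  "symplectic_form scale B \<longleftrightarrow>
     (\<forall>u. Vector_Spaces.linear scale (*) (\<lambda>v. B u v)) \<and>
     (\<forall>v. Vector_Spaces.linear scale (*) (\<lambda>u. B u v)) \<and>
     (\<forall>v. B v v = 0) \<and>
     (\<forall>u. (\<forall>v. B u v = 0) \<longrightarrow> u = 0)"

definition lagrangian ::
  "('f::field \<Rightarrow> 'v::ab_group_add \<Rightarrow> 'v) \<Rightarrow> ('v \<Rightarrow> 'v \<Rightarrow> 'f) \<Rightarrow> 'v set \<Rightarrow> bool" where
  "lagrangian scale B L \<longleftrightarrow> module.subspace scale L \<and> L = {v. \<forall>u\<in>L. B u v = 0}"


definition K_space :: "('n::nontriv mod_ring \<Rightarrow> 'v::ab_group_add set) \<Rightarrow>
    ('n mod_ring \<Rightarrow> 'v) set" where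
  "K_space l = {w. (\<forall>i. w i \<in> l i) \<and> (\<Sum>i\<in>UNIV. w i) = 0}"

(* h i stands for the value of the anti-derivative on the edge {i, i+1}. *)
definition antiderivative :: "('n::nontriv mod_ring \<Rightarrow> 'v::ab_group_add) \<Rightarrow>
    ('n mod_ring \<Rightarrow> 'v) \<Rightarrow> bool" where
  "antiderivative w h \<longleftrightarrow> (\<forall>i. h i - h (i - 1) = w i)"

(* Only meaningful for v, w in K_space l, where the choice of h does not matter. *)
definition q_form :: "('v::ab_group_add \<Rightarrow> 'v \<Rightarrow> 'f::field) \<Rightarrow>
    ('n::nontriv mod_ring \<Rightarrow> 'v) \<Rightarrow> ('n mod_ring \<Rightarrow> 'v) \<Rightarrow> 'f" where
  "q_form B v w = (let h = (SOME h. antiderivative w h) in \<Sum>i\<in>UNIV. B (v i) (h i))"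

definition q_kernel :: "('v::ab_group_add \<Rightarrow> 'v \<Rightarrow> 'f::field) \<Rightarrow>
    ('n::nontriv mod_ring \<Rightarrow> 'v set) \<Rightarrow> ('n mod_ring \<Rightarrow> 'v) set" where
  "q_kernel B l = {w \<in> K_space l. \<forall>v\<in>K_space l. q_form B v w = 0}"

definition T_class :: "('v::ab_group_add \<Rightarrow> 'v \<Rightarrow> 'f::field) \<Rightarrow>
    ('n::nontriv mod_ring \<Rightarrow> 'v set) \<Rightarrow> ('n mod_ring \<Rightarrow> 'v) \<Rightarrow> ('n mod_ring \<Rightarrow> 'v) set" where
  "T_class B l w = w +o q_kernel B l"

definition T_space :: "('v::ab_group_add \<Rightarrow> 'v \<Rightarrow> 'f::field) \<Rightarrow>
    ('n::nontriv mod_ring \<Rightarrow> 'v set) \<Rightarrow> ('n mod_ring \<Rightarrow> 'v) set set" where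
  "T_space B l = T_class B l ` K_space l"

(* The form induced by q_form on the quotient: the common value on representatives. *)
definition qT_form :: "('v::ab_group_add \<Rightarrow> 'v \<Rightarrow> 'f::field) \<Rightarrow>
    ('n::nontriv mod_ring \<Rightarrow> 'v) set \<Rightarrow> ('n mod_ring \<Rightarrow> 'v) set \<Rightarrow> 'f" where
  "qT_form B C D = (THE c. \<forall>v\<in>C. \<forall>w\<in>D. q_form B v w = c)"

(* Linearity is expressed through the operations [v] + [w] = [v + w], c [v] = [c v] of the quotient.
   Elements of the dual space are extensional, i.e. undefined outside T_space B l. *)
definition T_dual :: "('f::field \<Rightarrow> 'v::ab_group_add \<Rightarrow> 'v) \<Rightarrow> ('v \<Rightarrow> 'v \<Rightarrow> 'f) \<Rightarrow>
    ('n::nontriv mod_ring \<Rightarrow> 'v set) \<Rightarrow> (('n mod_ring \<Rightarrow> 'v) set \<Rightarrow> 'f) set" where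
  "T_dual scale B l = {f \<in> extensional (T_space B l).
     (\<forall>v\<in>K_space l. \<forall>w\<in>K_space l.
        f (T_class B l (v + w)) = f (T_class B l v) + f (T_class B l w)) \<and>
     (\<forall>c. \<forall>v\<in>K_space l.
        f (T_class B l (\<lambda>i. scale c (v i))) = c * f (T_class B l v))}"

definition T_to_dual :: "('v::ab_group_add \<Rightarrow> 'v \<Rightarrow> 'f::field) \<Rightarrow>
    ('n::nontriv mod_ring \<Rightarrow> 'v set) \<Rightarrow>
    ('n mod_ring \<Rightarrow> 'v) set \<Rightarrow> (('n mod_ring \<Rightarrow> 'v) set \<Rightarrow> 'f)" where
  "T_to_dual B l D = (\<lambda>C\<in>T_space B l. qT_form B C D)"

definition q_dual :: "('f::field \<Rightarrow> 'v::ab_group_add \<Rightarrow> 'v) \<Rightarrow> ('v \<Rightarrow> 'v \<Rightarrow> 'f) \<Rightarrow>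
    ('n::nontriv mod_ring \<Rightarrow> 'v set) \<Rightarrow>
    (('n mod_ring \<Rightarrow> 'v) set \<Rightarrow> 'f) \<Rightarrow> (('n mod_ring \<Rightarrow> 'v) set \<Rightarrow> 'f) \<Rightarrow> 'f" where
  "q_dual scale B l =
     (\<lambda>x\<in>T_dual scale B l. \<lambda>y\<in>T_dual scale B l.
        x (inv_into (T_space B l) (T_to_dual B l) y))"


(* Elements of the direct sum of the V / l i are families of cosets. *)
definition S_space :: "('n::nontriv mod_ring \<Rightarrow> 'v::ab_group_add set) \<Rightarrow>
    ('n mod_ring \<Rightarrow> 'v set) set" where
  "S_space l = {X. (\<forall>i. X i \<in> range (\<lambda>v. v +o l i)) \<and>
     (\<forall>i. \<forall>u\<in>X i. \<forall>u'\<in>X (i + 1). u' - u \<in> l i + l (i + 1))}"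

(* The value at C is the common value over all representatives v of C in K_space l and all
   families x of lifts of X. *)
definition S_to_T_dual :: "('v::ab_group_add \<Rightarrow> 'v \<Rightarrow> 'f::field) \<Rightarrow>
    ('n::nontriv mod_ring \<Rightarrow> 'v set) \<Rightarrow>
    ('n mod_ring \<Rightarrow> 'v set) \<Rightarrow> (('n mod_ring \<Rightarrow> 'v) set \<Rightarrow> 'f)" where
  "S_to_T_dual B l X = (\<lambda>C\<in>T_space B l.
     THE c. \<forall>v\<in>C. \<forall>x. (\<forall>i. x i \<in> X i) \<longrightarrow> (\<Sum>i\<in>UNIV. B (v i) (x i)) = c)"

(* Only meaningful when x' - x \<in> L + M, where the value does not depend on a and b. *)
definition epsilon :: "('v::ab_group_add \<Rightarrow> 'v \<Rightarrow> 'f::field) \<Rightarrow>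
    'v set \<Rightarrow> 'v set \<Rightarrow> 'v \<Rightarrow> 'v \<Rightarrow> ('v \<Rightarrow> 'f)" where
  "epsilon B L M x x' = (\<lambda>v\<in>L + M.
     THE c. \<forall>a\<in>L. \<forall>b\<in>M. v = a + b \<longrightarrow> c = B a x + B b x')"

end

theory Submission
  imports Defs
begin

text \<open>The dual form can be evaluated as soon as the functional of \<open>Y\<close> is written as \<open>q(_, w)\<close>
  for an explicit \<open>w\<close>, because the value at \<open>(X, Y)\<close> is then the functional of \<open>X\<close> at the class
  of \<open>w\<close>. The condition defining \<open>S\<close> provides such a \<open>w\<close>. Split every increment as
  \<open>y (i + 1) - y i = a i + b (i + 1)\<close> with \<open>a i \<in> l i\<close> and \<open>b (i + 1) \<in> l (i + 1)\<close>. Moving \<open>y i\<close>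
  by \<open>a i\<close> does not change its pairing with \<open>l i\<close>, and the moved family \<open>y + a\<close> has increments
  \<open>w i = a i + b i\<close>, which lie in \<open>l i\<close>. Hence \<open>w \<in> K\<close>, the family \<open>y + a\<close> is an
  anti-derivative of \<open>w\<close>, and \<open>q(v, w) = \<Sum>i. B (v i) (y i)\<close> for every \<open>v \<in> K\<close>
  (\<open>q_form_regrouped_increments\<close>). The value of the dual form is
  \<open>\<Sum>i. B (a i + b i) (x i) = \<Sum>i. (B (a i) (x i) + B (b (i + 1)) (x (i + 1)))\<close>,
  and the summand on the right is the value of \<open>\<epsilon>\<close> at \<open>a i + b (i + 1) = y (i + 1) - y i\<close>.

  The quotients and duals are meaningful because anti-derivatives exist on \<open>K\<close>
  (\<open>antiderivative_exists\<close>) and \<open>q\<close> is symmetric (\<open>q_form_commute\<close>). Symmetry makes \<open>q\<close> and the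
  functionals of \<open>S\<close> descend to \<open>T\<close>, and the map from \<open>T\<close> to its dual is injective
  (\<open>inj_on_T_to_dual\<close>) because the kernel of \<open>q\<close> has been divided out, so that the class of \<open>w\<close> is
  the only preimage.\<close>

section \<open>Anti-derivatives on the cyclic index group\<close>

lemma mod_ring_of_nat_cases:
  fixes i :: "'n::nontriv mod_ring"
  obtains k where "k < CARD('n)" "i = of_nat k" "nat (to_int_mod_ring i) = k"
proof
  let ?k = "nat (to_int_mod_ring i)"
  have bounds: "0 \<le> to_int_mod_ring i" "to_int_mod_ring i < int CARD('n)"
    using range_to_int_mod_ring[where 'a='n] by auto
  then show "?k < CARD('n)"
    by linarith
  show "i = of_nat ?k"
    using bounds by (simp add: of_nat_of_int_mod_ring)
qed simp

lemma nat_to_int_mod_ring_of_nat: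
  "k < CARD('n::nontriv) \<Longrightarrow> nat (to_int_mod_ring (of_nat k :: 'n mod_ring)) = k"
  by (simp add: of_nat_of_int_mod_ring)

lemma sum_mod_ring_eq_sum_of_nat:
  fixes f :: "'n::nontriv mod_ring \<Rightarrow> 'a::comm_monoid_add"
  shows "(\<Sum>i\<in>UNIV. f i) = (\<Sum>k<CARD('n). f (of_nat k))"
proof (rule sum.reindex_bij_witness[where i = of_nat and j = "\<lambda>i. nat (to_int_mod_ring i)"])
  fix i :: "'n mod_ring"
  show "of_nat (nat (to_int_mod_ring i)) = i" "nat (to_int_mod_ring i) \<in> {..<CARD('n)}"
    by (rule mod_ring_of_nat_cases[of i]; simp)+
  then show "f (of_nat (nat (to_int_mod_ring i))) = f i"
    by simp
qed (simp_all add: nat_to_int_mod_ring_of_nat)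

lemma sum_mod_ring_shift:
  fixes f :: "'n::nontriv mod_ring \<Rightarrow> 'a::comm_monoid_add"
  shows "(\<Sum>i\<in>UNIV. f (i - 1)) = (\<Sum>i\<in>UNIV. f i)"
  by (rule sum.reindex_bij_witness[where i = "\<lambda>i. i + 1" and j = "\<lambda>i. i - 1"]) auto

lemma mod_ring_function_constant:
  fixes f :: "'n::nontriv mod_ring \<Rightarrow> 'a"
  assumes "\<And>i. f i = f (i - 1)"
  shows "f i = f 0"
proof -
  have "f (of_nat k) = f 0" for k
  proof (induction k)
    case (Suc k)
    then show ?case
      using assms[of "of_nat (Suc k)"] by simp
  qed simp
  then show ?thesis
    by (metis mod_ring_of_nat_cases)
qed

text \<open>The partial sums of \<^term>\<open>w\<close> along the representatives \<open>0, \<dots>, n - 1\<close> are an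
  anti-derivative. The only edge where this could go wrong is the one from \<open>n - 1\<close> back to \<open>0\<close>,
  and there the defect is the total sum of \<^term>\<open>w\<close>.\<close>

lemma antiderivative_exists:
  fixes w :: "'n::nontriv mod_ring \<Rightarrow> 'v::ab_group_add"
  assumes "(\<Sum>i\<in>UNIV. w i) = 0"
  shows "\<exists>h. antiderivative w h"
proof -
  define h where "h i = (\<Sum>k\<le>nat (to_int_mod_ring i). w (of_nat k))" for i :: "'n mod_ring"
  have h_of_nat: "h (of_nat k) = (\<Sum>j<Suc k. w (of_nat j))" if "k < CARD('n)" for k
    using that by (simp add: h_def nat_to_int_mod_ring_of_nat lessThan_Suc_atMost)
  have "h i - h (i - 1) = w i" for i
  proof -
    obtain k where k: "k < CARD('n)" "i = of_nat k"
      by (rule mod_ring_of_nat_cases)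
    show ?thesis
    proof (cases k)
      case 0
      have "(of_nat (CARD('n) - 1) :: 'n mod_ring) = - 1"
        using nontriv[where 'a='n] by (simp add: of_nat_diff)
      then have "h (- 1) = (\<Sum>j<Suc (CARD('n) - 1). w (of_nat j))"
        using h_of_nat[of "CARD('n) - 1"] by simp
      also have "\<dots> = 0"
        using assms by (simp add: sum_mod_ring_eq_sum_of_nat)
      finally show ?thesis
        using 0 k h_of_nat[of 0] by simp
    next
      case (Suc m)
      then have "i - 1 = of_nat m"
        using k by simp
      then show ?thesis
        using k Suc h_of_nat[of k] h_of_nat[of m] by simp
    qed
  qed
  then show ?thesis
    by (auto simp: antiderivative_def)
qed

lemma antiderivative_unique:
  fixes w :: "'n::nontriv mod_ring \<Rightarrow> 'v::ab_group_add"
  assumes "antiderivative w h" "antiderivative w h'"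
  shows "h i = h' i + (h 0 - h' 0)"
proof -
  have step: "h j - h' j = h (j - 1) - h' (j - 1)" for j
  proof -
    have "h j - h (j - 1) = h' j - h' (j - 1)"
      using assms by (simp add: antiderivative_def)
    then show ?thesis
      by (simp add: algebra_simps)
  qed
  have "h i - h' i = h 0 - h' 0"
    by (rule mod_ring_function_constant[where f = "\<lambda>i. h i - h' i"]) (rule step)
  then show ?thesis
    by (simp add: algebra_simps)
qed

lemma antiderivative_plus:
  "antiderivative v g \<Longrightarrow> antiderivative w h \<Longrightarrow> antiderivative (v + w) (g + h)"
  by (simp add: antiderivative_def add_diff_add)

section \<open>The form on the quotient\<close>

text \<open>Isotropy acts termwise in the cyclic sums: it is the source of the symmetry of \<open>q\<close>, and it
  makes pairings of \<open>v i \<in> l i\<close> with a coset of \<open>l i\<close> independent of the representative.\<close>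

locale isotropic_family = vector_space scale
  for scale :: "'f::field \<Rightarrow> 'v::ab_group_add \<Rightarrow> 'v" +
  fixes B :: "'v \<Rightarrow> 'v \<Rightarrow> 'f"
    and l :: "'n::nontriv mod_ring \<Rightarrow> 'v set"
  assumes add_left: "B (u + v) w = B u w + B v w"
    and add_right: "B u (v + w) = B u v + B u w"
    and scale_left: "B (scale c u) v = c * B u v"
    and alternating: "B v v = 0"
    and subspace_l: "subspace (l i)"
    and isotropic: "u \<in> l i \<Longrightarrow> v \<in> l i \<Longrightarrow> B u v = 0"
begin

lemma additive_left: "additive (\<lambda>u. B u w)"
  by (simp add: additive_def add_left)

lemma additive_right: "additive (B u)"
  by (simp add: additive_def add_right)

lemmas diff_left = additive.diff[OF additive_left]
  and diff_right = additive.diff[OF additive_right]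
  and zero_left = additive.zero[OF additive_left]
  and sum_left = additive.sum[OF additive_left]

lemma skew: "B u v = - B v u"
  using alternating[of "u + v"] alternating[of u] alternating[of v]
  by (simp add: add_left add_right eq_neg_iff_add_eq_0 add.commute)

lemma K_space_antiderivative:
  assumes "w \<in> K_space l"
  obtains h where "antiderivative w h"
  using assms antiderivative_exists[of w] by (auto simp: K_space_def)

lemma K_space_plus: "v \<in> K_space l \<Longrightarrow> w \<in> K_space l \<Longrightarrow> v + w \<in> K_space l"
  by (auto simp: K_space_def sum.distrib intro: subspace_add[OF subspace_l])

lemma K_space_minus: "v \<in> K_space l \<Longrightarrow> w \<in> K_space l \<Longrightarrow> v - w \<in> K_space l"
  by (auto simp: K_space_def sum_subtractf intro: subspace_diff[OF subspace_l])

lemma K_space_scale: "v \<in> K_space l \<Longrightarrow> (\<lambda>i. scale c (v i)) \<in> K_space l"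
  by (auto simp: K_space_def scale_sum_right[symmetric] intro: subspace_scale[OF subspace_l])

text \<open>Changing the anti-derivative by a constant changes the sum by the pairing of
  \<open>\<Sum>i. v i = 0\<close> with this constant.\<close>

lemma q_form_eq:
  assumes "v \<in> K_space l" "antiderivative w h"
  shows "q_form B v w = (\<Sum>i\<in>UNIV. B (v i) (h i))"
proof -
  define h' where "h' = (SOME h. antiderivative w h)"
  have "antiderivative w h'"
    unfolding h'_def using assms(2) by (rule someI[of "antiderivative w"])
  then have "(\<Sum>i\<in>UNIV. B (v i) (h' i)) = (\<Sum>i\<in>UNIV. B (v i) (h i) + B (v i) (h' 0 - h 0))"
    using antiderivative_unique[OF _ assms(2), of h'] by (metis add_right)
  also have "\<dots> = (\<Sum>i\<in>UNIV. B (v i) (h i)) + B (\<Sum>i\<in>UNIV. v i) (h' 0 - h 0)"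
    by (simp add: sum.distrib sum_left)
  also have "B (\<Sum>i\<in>UNIV. v i) (h' 0 - h 0) = 0"
    using assms(1) by (simp add: K_space_def zero_left)
  finally show ?thesis
    by (simp add: q_form_def h'_def Let_def)
qed

lemma q_form_plus_left:
  assumes "u \<in> K_space l" "v \<in> K_space l" "w \<in> K_space l"
  shows "q_form B (u + v) w = q_form B u w + q_form B v w"
proof -
  obtain h where "antiderivative w h"
    using assms(3) by (rule K_space_antiderivative)
  then show ?thesis
    using assms by (simp add: q_form_eq K_space_plus add_left sum.distrib)
qed

lemma q_form_plus_right:
  assumes "u \<in> K_space l" "v \<in> K_space l" "w \<in> K_space l"
  shows "q_form B u (v + w) = q_form B u v + q_form B u w"
proof -
  obtain g h where "antiderivative v g" "antiderivative w h"
    using assms by (metis K_space_antiderivative)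
  then show ?thesis
    using assms antiderivative_plus[of v g w h]
    by (simp add: q_form_eq add_right sum.distrib)
qed

lemma q_form_minus_right:
  assumes "u \<in> K_space l" "v \<in> K_space l" "w \<in> K_space l"
  shows "q_form B u (v - w) = q_form B u v - q_form B u w"
  using q_form_plus_right[of u "v - w" w] assms by (simp add: K_space_minus)

text \<open>For anti-derivatives \<open>g\<close> of \<open>v\<close> and \<open>h\<close> of \<open>w\<close>, summation by parts turns the difference of
  the two sides into \<open>\<Sum>i. B (g i - g (i - 1)) (h i - h (i - 1))\<close>. Its terms are
  \<open>B (v i) (w i)\<close>, which vanish because \<open>l i\<close> is isotropic.\<close>

lemma q_form_commute:
  assumes "v \<in> K_space l" "w \<in> K_space l"
  shows "q_form B v w = q_form B w v"
proof -
  obtain g h where g: "antiderivative v g" and h: "antiderivative w h"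
    using assms by (metis K_space_antiderivative)
  have v: "v i = g i - g (i - 1)" and w: "w i = h i - h (i - 1)" for i
    using g h by (simp_all add: antiderivative_def)
  have "(\<Sum>i\<in>UNIV. B (v i) (h i)) - (\<Sum>i\<in>UNIV. B (w i) (g i))
      = (\<Sum>i\<in>UNIV. B (g i) (h i)) + (\<Sum>i\<in>UNIV. B (g i) (h i))
        - (\<Sum>i\<in>UNIV. B (g (i - 1)) (h i)) - (\<Sum>i\<in>UNIV. B (g i) (h (i - 1)))"
    unfolding skew[of "w _"] unfolding v w diff_left diff_right
    by (simp add: sum.distrib sum_subtractf sum_negf)
  also have "\<dots> = (\<Sum>i\<in>UNIV. B (g i) (h i)) + (\<Sum>i\<in>UNIV. B (g (i - 1)) (h (i - 1)))
        - (\<Sum>i\<in>UNIV. B (g (i - 1)) (h i)) - (\<Sum>i\<in>UNIV. B (g i) (h (i - 1)))"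
    by (simp only: sum_mod_ring_shift[where f = "\<lambda>i. B (g i) (h i)"])
  also have "\<dots> = (\<Sum>i\<in>UNIV. B (v i) (w i))"
    unfolding v w diff_left diff_right by (simp add: sum.distrib sum_subtractf)
  also have "\<dots> = 0"
    using assms by (intro sum.neutral) (auto simp: K_space_def intro: isotropic)
  finally show ?thesis
    using assms g h by (simp add: q_form_eq)
qed

lemma q_kernel_iff:
  "k \<in> q_kernel B l \<longleftrightarrow> k \<in> K_space l \<and> (\<forall>v\<in>K_space l. q_form B v k = 0)"
  by (simp add: q_kernel_def)

lemma q_kernel_zero: "0 \<in> q_kernel B l"
proof -
  have zero_right: "B u 0 = 0" for u
    by (rule additive.zero[OF additive_right])
  have "antiderivative (0 :: 'n mod_ring \<Rightarrow> 'v) 0"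
    by (simp add: antiderivative_def)
  then have "q_form B v 0 = 0" if "v \<in> K_space l" for v
    using q_form_eq[OF that] by (simp add: zero_right)
  then show ?thesis
    by (simp add: q_kernel_iff K_space_def subspace_0[OF subspace_l])
qed

lemma q_kernel_plus: "u \<in> q_kernel B l \<Longrightarrow> v \<in> q_kernel B l \<Longrightarrow> u + v \<in> q_kernel B l"
  by (simp add: q_kernel_iff K_space_plus q_form_plus_right)

lemma q_kernel_minus: "u \<in> q_kernel B l \<Longrightarrow> v \<in> q_kernel B l \<Longrightarrow> u - v \<in> q_kernel B l"
  by (simp add: q_kernel_iff K_space_minus q_form_minus_right)

lemma T_class_elim:
  assumes "v' \<in> T_class B l v"
  obtains k where "k \<in> q_kernel B l" "v' = v + k"
  using assms by (auto simp: T_class_def elt_set_plus_def)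

lemma T_class_self: "v \<in> T_class B l v"
  using q_kernel_zero unfolding T_class_def elt_set_plus_def by (auto intro!: bexI[of _ 0])

lemma T_class_eqI:
  assumes "v - w \<in> q_kernel B l"
  shows "T_class B l v = T_class B l w"
proof -
  have "v + k = w + (v - w + k)" and "w + k = v + (k - (v - w))" for k
    by simp_all
  then show ?thesis
    using q_kernel_plus[OF assms] q_kernel_minus[OF _ assms]
    unfolding T_class_def elt_set_plus_def by blast
qed

lemma qT_form_T_class:
  assumes v: "v \<in> K_space l" and w: "w \<in> K_space l"
  shows "qT_form B (T_class B l v) (T_class B l w) = q_form B v w"
proof -
  have common: "q_form B v' w' = q_form B v w" if v': "v' \<in> T_class B l v" and w': "w' \<in> T_class B l w"
    for v' w'
  proof -
    obtain k where k: "k \<in> q_kernel B l" "v' = v + k"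
      using v' by (rule T_class_elim)
    obtain m where m: "m \<in> q_kernel B l" "w' = w + m"
      using w' by (rule T_class_elim)
    have "q_form B k w = q_form B w k"
      using k w by (simp add: q_kernel_iff q_form_commute)
    then show ?thesis
      using v w k m
      by (simp add: q_kernel_iff K_space_plus q_form_plus_left q_form_plus_right)
  qed
  show ?thesis
    unfolding qT_form_def
  proof (rule the_equality)
    show "c = q_form B v w"
      if "\<forall>v'\<in>T_class B l v. \<forall>w'\<in>T_class B l w. q_form B v' w' = c" for c
      using that[rule_format, OF T_class_self T_class_self] by (rule sym)
  qed (use common in blast)
qed

lemma T_to_dual_apply:
  "v \<in> K_space l \<Longrightarrow> w \<in> K_space l \<Longrightarrow> T_to_dual B l (T_class B l w) (T_class B l v) = q_form B v w"
  by (simp add: T_to_dual_def T_space_def qT_form_T_class)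

lemma inj_on_T_to_dual: "inj_on (T_to_dual B l) (T_space B l)"
proof (rule inj_onI)
  fix C D
  assume "C \<in> T_space B l" "D \<in> T_space B l" and eq: "T_to_dual B l C = T_to_dual B l D"
  then obtain v w where v: "v \<in> K_space l" "C = T_class B l v"
    and w: "w \<in> K_space l" "D = T_class B l w"
    by (auto simp: T_space_def)
  have "q_form B u v = q_form B u w" if "u \<in> K_space l" for u
    using T_to_dual_apply[OF that v(1)] T_to_dual_apply[OF that w(1)] v w eq by simp
  then have "v - w \<in> q_kernel B l"
    using v w by (simp add: q_kernel_iff K_space_minus q_form_minus_right)
  then show "C = D"
    using v w by (simp add: T_class_eqI)
qed

section \<open>The map from lifted families to the dual space\<close>

text \<open>Splitting the increments of a compatible family \<open>y\<close> produces a preimage of its functional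
  under \<^const>\<open>T_to_dual\<close>. With the part \<open>b (i + 1) \<in> l (i + 1)\<close> of the increment
  \<open>y (i + 1) - y i\<close> regrouped to the index \<open>i + 1\<close>, the family \<open>a + b\<close> lies in \<open>K\<close> and has
  the anti-derivative \<open>y + a\<close>; the pairings with \<open>y + a\<close> and with \<open>y\<close> agree because \<open>a i\<close> is
  orthogonal to \<open>l i\<close>.\<close>

lemma regrouped_increments:
  assumes a: "\<And>i. a i \<in> l i" and b: "\<And>i. b i \<in> l i"
    and y: "\<And>i. y (i + 1) - y i = a i + b (i + 1)"
  shows regrouped_increments_in_K_space: "a + b \<in> K_space l"
    and q_form_regrouped_increments:
      "v \<in> K_space l \<Longrightarrow> q_form B v (a + b) = (\<Sum>i\<in>UNIV. B (v i) (y i))"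
proof -
  have anti: "antiderivative (a + b) (y + a)"
    unfolding antiderivative_def
  proof
    fix i
    show "(y + a) i - (y + a) (i - 1) = (a + b) i"
      using y[of "i - 1"] by (simp add: algebra_simps)
  qed
  have "(a + b) i = (y + a) i - (y + a) (i - 1)" for i
    using anti unfolding antiderivative_def by metis
  then have "(\<Sum>i\<in>UNIV. (a + b) i) = (\<Sum>i\<in>UNIV. (y + a) i) - (\<Sum>i\<in>UNIV. (y + a) (i - 1))"
    by (simp only: sum_subtractf)
  also have "\<dots> = 0"
    by (simp add: sum_mod_ring_shift[where f = "y + a"] del: plus_fun_apply)
  finally show "a + b \<in> K_space l"
    using a b by (auto simp: K_space_def intro: subspace_add[OF subspace_l])
  assume v: "v \<in> K_space l"
  have "B (v i) (a i) = 0" for i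
    using v a by (auto simp: K_space_def intro: isotropic)
  then show "q_form B v (a + b) = (\<Sum>i\<in>UNIV. B (v i) (y i))"
    using q_form_eq[OF v anti] by (simp add: add_right)
qed

lemma S_space_lift_increments:
  assumes "X \<in> S_space l" "\<And>i. x i \<in> X i"
  obtains a b where "\<And>i. a i \<in> l i" "\<And>i. b i \<in> l i"
    "\<And>i. x (i + 1) - x i = a i + b (i + 1)"
proof -
  have "x (i + 1) - x i \<in> l i + l (i + 1)" for i
    using assms by (simp add: S_space_def)
  then have "\<exists>p q. p \<in> l i \<and> q \<in> l (i + 1) \<and> x (i + 1) - x i = p + q" for i
    by (metis set_plus_elim)
  then obtain p q where pq: "\<And>i. p i \<in> l i" "\<And>i. q i \<in> l (i + 1)"
    "\<And>i. x (i + 1) - x i = p i + q i"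
    by metis
  show thesis
  proof (rule that[of p "\<lambda>i. q (i - 1)"])
    show "q (i - 1) \<in> l i" for i
      using pq(2)[of "i - 1"] by simp
  qed (use pq in simp_all)
qed

lemma S_space_lifts_differ:
  assumes "X \<in> S_space l" "u \<in> X i" "u' \<in> X i"
  shows "u' - u \<in> l i"
proof -
  have "X i \<in> range (\<lambda>v. v +o l i)"
    using assms(1) by (simp add: S_space_def)
  then obtain c where "X i = c +o l i"
    by blast
  then obtain p p' where "p \<in> l i" "p' \<in> l i" "u = c + p" "u' = c + p'"
    using assms by (auto simp: elt_set_plus_def)
  then show ?thesis
    by (simp add: subspace_diff[OF subspace_l])
qed

text \<open>The functional is of the form \<open>q(_, w)\<close> by \<open>q_form_regrouped_increments\<close>, so by symmetry it
  kills the kernel of \<open>q\<close> and descends to the quotient. Two lifts of a component differ by an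
  element of \<open>l i\<close>, which is orthogonal to \<open>v i\<close>.\<close>

lemma S_to_T_dual_apply:
  assumes X: "X \<in> S_space l" and x: "\<And>i. x i \<in> X i" and v: "v \<in> K_space l"
  shows "S_to_T_dual B l X (T_class B l v) = (\<Sum>i\<in>UNIV. B (v i) (x i))"
proof -
  obtain a b where ab: "\<And>i. a i \<in> l i" "\<And>i. b i \<in> l i"
    "\<And>i. x (i + 1) - x i = a i + b (i + 1)"
    using S_space_lift_increments[OF X x] by metis
  have common: "(\<Sum>i\<in>UNIV. B (v' i) (x' i)) = (\<Sum>i\<in>UNIV. B (v i) (x i))"
    if v': "v' \<in> T_class B l v" and x': "\<forall>i. x' i \<in> X i" for v' x'
  proof -
    obtain k where k: "k \<in> q_kernel B l" "v' = v + k"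
      using v' by (rule T_class_elim)
    have kK: "k \<in> K_space l"
      using k by (simp add: q_kernel_iff)
    have "v' \<in> K_space l"
      using v k kK by (simp add: K_space_plus)
    then have "B (v' i) (x' i - x i) = 0" for i
      using S_space_lifts_differ[OF X x] x' by (auto simp: K_space_def intro: isotropic)
    then have "(\<Sum>i\<in>UNIV. B (v' i) (x' i)) = (\<Sum>i\<in>UNIV. B (v' i) (x i))"
      by (simp add: diff_right)
    also have "\<dots> = (\<Sum>i\<in>UNIV. B (v i) (x i)) + (\<Sum>i\<in>UNIV. B (k i) (x i))"
      by (simp add: k add_left sum.distrib)
    also have "(\<Sum>i\<in>UNIV. B (k i) (x i)) = q_form B k (a + b)"
      using q_form_regrouped_increments[of a b x, OF ab kK] by simp
    also have "\<dots> = q_form B (a + b) k"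
      using kK regrouped_increments_in_K_space[of a b x, OF ab] by (rule q_form_commute)
    also have "\<dots> = 0"
      using k regrouped_increments_in_K_space[of a b x, OF ab] by (simp add: q_kernel_iff)
    finally show ?thesis
      by simp
  qed
  have "(THE c. \<forall>v'\<in>T_class B l v. \<forall>x'. (\<forall>i. x' i \<in> X i) \<longrightarrow> (\<Sum>i\<in>UNIV. B (v' i) (x' i)) = c)
      = (\<Sum>i\<in>UNIV. B (v i) (x i))"
  proof (rule the_equality)
    show "c = (\<Sum>i\<in>UNIV. B (v i) (x i))"
      if "\<forall>v'\<in>T_class B l v. \<forall>x'. (\<forall>i. x' i \<in> X i) \<longrightarrow> (\<Sum>i\<in>UNIV. B (v' i) (x' i)) = c" for c
      using that[rule_format, OF T_class_self x] by (rule sym)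
  qed (use common in blast)
  then show ?thesis
    using v by (simp add: S_to_T_dual_def T_space_def)
qed

lemma S_to_T_dual_in_T_dual:
  assumes "X \<in> S_space l" "\<And>i. x i \<in> X i"
  shows "S_to_T_dual B l X \<in> T_dual scale B l"
proof -
  have "S_to_T_dual B l X \<in> extensional (T_space B l)"
    by (simp add: S_to_T_dual_def)
  then show ?thesis
    by (simp add: T_dual_def S_to_T_dual_apply[OF assms] K_space_plus K_space_scale
        add_left scale_left sum.distrib sum_distrib_left)
qed

lemma T_to_dual_regrouped_increments:
  assumes Y: "Y \<in> S_space l" "\<And>i. y i \<in> Y i"
    and ab: "\<And>i. a i \<in> l i" "\<And>i. b i \<in> l i" "\<And>i. y (i + 1) - y i = a i + b (i + 1)"
  shows "T_to_dual B l (T_class B l (a + b)) = S_to_T_dual B l Y"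
proof (rule extensionalityI[of _ "T_space B l"])
  fix C
  assume "C \<in> T_space B l"
  then obtain v where v: "v \<in> K_space l" "C = T_class B l v"
    by (auto simp: T_space_def)
  show "T_to_dual B l (T_class B l (a + b)) C = S_to_T_dual B l Y C"
    using v regrouped_increments_in_K_space[of a b y, OF ab]
      q_form_regrouped_increments[of a b y, OF ab v(1)]
    by (simp add: T_to_dual_apply S_to_T_dual_apply[OF Y])
qed (simp_all add: T_to_dual_def S_to_T_dual_def)

section \<open>The dual form\<close>

text \<open>Two decompositions of the same vector differ by an element of \<open>l i \<inter> l j\<close>, and this
  intersection is orthogonal to \<open>l i + l j\<close>, hence to \<open>x' - x\<close>.\<close>

lemma epsilon_eq:
  assumes x: "x' - x \<in> l i + l j" and a: "a \<in> l i" and b: "b \<in> l j"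
  shows "epsilon B (l i) (l j) x x' (a + b) = B a x + B b x'"
proof -
  obtain p q where pq: "p \<in> l i" "q \<in> l j" "x' - x = p + q"
    using x by (rule set_plus_elim)
  have indep: "B a x + B b x' = B a' x + B b' x'"
    if "a' \<in> l i" "b' \<in> l j" "a + b = a' + b'" for a' b'
  proof -
    have eq: "a - a' = b' - b"
      using that(3) by (simp add: algebra_simps)
    have "a - a' \<in> l i" "a - a' \<in> l j"
      using a b that(1,2) by (auto simp: eq intro: subspace_diff[OF subspace_l])
        (auto simp flip: eq intro: subspace_diff[OF subspace_l])
    then have "B (a - a') (x' - x) = 0"
      using pq by (simp add: add_right isotropic[of _ i] isotropic[of _ j])
    then have "B (b' - b) x' = B (a - a') x"
      by (simp add: diff_right eq)
    then show ?thesis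
      by (simp add: diff_left algebra_simps)
  qed
  have "(THE c. \<forall>a'\<in>l i. \<forall>b'\<in>l j. a + b = a' + b' \<longrightarrow> c = B a' x + B b' x') = B a x + B b x'"
  proof (rule the_equality)
    show "c = B a x + B b x'"
      if "\<forall>a'\<in>l i. \<forall>b'\<in>l j. a + b = a' + b' \<longrightarrow> c = B a' x + B b' x'" for c
      using that a b by blast
  qed (use indep in blast)
  then show ?thesis
    using a b by (simp add: epsilon_def set_plus_intro)
qed

lemma q_dual_S_to_T_dual:
  assumes X: "X \<in> S_space l" "\<And>i. x i \<in> X i" and Y: "Y \<in> S_space l" "\<And>i. y i \<in> Y i"
  shows "q_dual scale B l (S_to_T_dual B l X) (S_to_T_dual B l Y) =
    (\<Sum>i\<in>UNIV. epsilon B (l i) (l (i + 1)) (x i) (x (i + 1)) (y (i + 1) - y i))"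
proof -
  obtain a b where ab: "\<And>i. a i \<in> l i" "\<And>i. b i \<in> l i"
    "\<And>i. y (i + 1) - y i = a i + b (i + 1)"
    using S_space_lift_increments[OF Y] by metis
  have K: "a + b \<in> K_space l"
    using ab by (rule regrouped_increments_in_K_space)
  have "inv_into (T_space B l) (T_to_dual B l) (S_to_T_dual B l Y) = T_class B l (a + b)"
    using K by (intro inv_into_f_eq inj_on_T_to_dual T_to_dual_regrouped_increments[OF Y ab])
      (auto simp: T_space_def)
  then have "q_dual scale B l (S_to_T_dual B l X) (S_to_T_dual B l Y)
      = (\<Sum>i\<in>UNIV. B (a i + b i) (x i))"
    using S_to_T_dual_in_T_dual[OF X] S_to_T_dual_in_T_dual[OF Y] S_to_T_dual_apply[OF X K]
    by (simp add: q_dual_def)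
  also have "\<dots> = (\<Sum>i\<in>UNIV. B (a i) (x i)) + (\<Sum>i\<in>UNIV. B (b i) (x i))"
    by (simp add: add_left sum.distrib)
  \<comment> \<open>The regrouping is undone: \<open>b (i + 1)\<close> belongs to the increment from \<open>i\<close> to \<open>i + 1\<close>.\<close>
  also have "\<dots> = (\<Sum>i\<in>UNIV. B (a i) (x i) + B (b (i + 1)) (x (i + 1)))"
    using sum_mod_ring_shift[where f = "\<lambda>i. B (b (i + 1)) (x (i + 1))"] by (simp add: sum.distrib)
  also have "\<dots> = (\<Sum>i\<in>UNIV. epsilon B (l i) (l (i + 1)) (x i) (x (i + 1)) (y (i + 1) - y i))"
  proof (rule sum.cong)
    fix i
    have "x (i + 1) - x i \<in> l i + l (i + 1)"
      using X by (auto simp: S_space_def)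
    then show "B (a i) (x i) + B (b (i + 1)) (x (i + 1))
        = epsilon B (l i) (l (i + 1)) (x i) (x (i + 1)) (y (i + 1) - y i)"
      using ab by (simp add: epsilon_eq)
  qed simp
  finally show ?thesis .
qed

end

lemma lagrangian_family_isotropic:
  assumes "symplectic_form scale B" "\<And>i. lagrangian scale B (l i)"
  shows "isotropic_family scale B l"
proof -
  have lin: "Vector_Spaces.linear scale (*) (\<lambda>u. B u v)"
    "Vector_Spaces.linear scale (*) (\<lambda>v. B u v)" for u v
    using assms(1) by (auto simp: symplectic_form_def)
  interpret L: Vector_Spaces.linear scale "(*)" "\<lambda>u. B u v" for v
    by (rule lin)
  interpret R: Vector_Spaces.linear scale "(*)" "\<lambda>v. B u v" for u
    by (rule lin)
  show ?thesis
  proof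
    show "module.subspace scale (l i)" for i
      using assms(2) by (simp add: lagrangian_def)
    show "B u v = 0" if "u \<in> l i" "v \<in> l i" for u v i
      using assms(2)[of i] that by (auto simp: lagrangian_def)
    show "B v v = 0" for v
      using assms(1) by (simp add: symplectic_form_def)
  qed (simp_all add: L.add R.add L.scale)
qed

theorem proposition4:
  fixes scale :: "'f::field \<Rightarrow> 'v::ab_group_add \<Rightarrow> 'v"
    and Basis :: "'v set"
    and B :: "'v \<Rightarrow> 'v \<Rightarrow> 'f"
    and l :: "'n::nontriv mod_ring \<Rightarrow> 'v set"
    and X Y :: "'n mod_ring \<Rightarrow> 'v set"
    and x y :: "'n mod_ring \<Rightarrow> 'v"
  assumes "CHAR('f) \<noteq> 2"
    and "finite_dimensional_vector_space scale Basis"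
    and "symplectic_form scale B"
    and "\<And>i. lagrangian scale B (l i)"
    and "X \<in> S_space l" and "Y \<in> S_space l"
    and "\<And>i. x i \<in> X i" and "\<And>i. y i \<in> Y i"
  shows "q_dual scale B l (S_to_T_dual B l X) (S_to_T_dual B l Y) =
    (\<Sum>i\<in>UNIV. epsilon B (l i) (l (i + 1)) (x i) (x (i + 1)) (y (i + 1) - y i))"
  using isotropic_family.q_dual_S_to_T_dual[OF lagrangian_family_isotropic] assms by blast

end
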